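(* Let $(X,d)$ be a complete separable metric space in which closed balls are compact, and let $\alpha:\mathbb{R}^+\to\mathbb{R}^+$ be an increasing convex function of class $\mathcal{C}^1$ with $\alpha(0)=0$. Let $f:X\to\mathbb{R}$ be an upper semicontinuous function bounded from above. For $t>0$ and $x\in X$ let $$P_tf(x)=\sup_{y\in X}\left\{f(y)-t\,\alpha\left(\frac{d(x,y)}{t}\right)\right\},\qquad m(t,x)=\left\{\bar y\in X:\ P_tf(x)=f(\bar y)-t\,\alpha\left(\frac{d(x,\bar y)}{t}\right)\right\}.$$ Then the sets $m(t,x)$ are always non-empty and compact, and for all $t>0$ and all $x\in X$, $$\frac{d}{dt_+}P_tf(x)=\beta\left(\frac1t\max_{\bar y\in m(t,x)}d(x,\bar y)\right)\qquad\text{and}\qquad \frac{d}{dt_-}P_tf(x)=\beta\left(\frac1t\min_{\bar y\in m(t,x)}d(x,\bar y)\right),$$ where $\beta(h)=h\alpha'(h)-\alpha(h)$, $h\ge0$.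
   Context: $\frac{d}{dt_+}$ and $\frac{d}{dt_-}$ denote respectively the right and left derivatives in $t$ (the statement includes their existence). *)

theory Defs
  imports "HOL-Analysis.Analysis"
begin

definition upper_semicontinuous :: "('a::topological_space \<Rightarrow> real) \<Rightarrow> bool" where
  "upper_semicontinuous f \<longleftrightarrow> (\<forall>c. open {x. f x < c})"

(* The supremum is taken in the type of reals, so it is meaningful only when the family is bounded
   above; this holds for t > 0, f bounded above and \<alpha> nonnegative on the half-line. *)
definition sup_conv :: "(real \<Rightarrow> real) \<Rightarrow> ('a::metric_space \<Rightarrow> real) \<Rightarrow> real \<Rightarrow> 'a \<Rightarrow> real" where
  "sup_conv \<alpha> f t x = (SUP y. f y - t * \<alpha> (dist x y / t))"

definition maximizers :: "(real \<Rightarrow> real) \<Rightarrow> ('a::metric_space \<Rightarrow> real) \<Rightarrow> real \<Rightarrow> 'a \<Rightarrow> 'a set" where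
  "maximizers \<alpha> f t x = {y. sup_conv \<alpha> f t x = f y - t * \<alpha> (dist x y / t)}"

end

theory Submission
  imports Defs
begin

text \<open>
  Write \<open>g s y = f y - s * \<alpha> (d(x,y) / s)\<close>. Convexity of \<open>\<alpha>\<close> yields
  \<open>g s y - g t y \<le> (s - t) * \<beta> (d(x,y) / t)\<close> for all positive \<open>s\<close>, \<open>t\<close>. Inserting a maximizer
  at time \<open>t\<close> and a maximizer at time \<open>s\<close> encloses the difference quotient of
  \<open>P\<^sub>t f(x)\<close> between two values of \<open>\<beta>\<close>. Since \<open>\<alpha>\<close> grows at least
  linearly, near-maximizers along \<open>s \<longlongrightarrow> t\<close> stay in a compact ball, and by upper semicontinuity
  they accumulate only at maximizers for \<open>t\<close>; as \<open>\<beta>\<close> is monotone and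
  continuous, both bounds converge to the extremal value.
\<close>

section \<open>Supporting lines of convex functions on the closed half-line\<close>

text \<open>At an interior tangent point \<open>v > 0\<close> this is the usual supporting-line
  inequality; the endpoint \<open>v = 0\<close> is reached by letting the tangent point decrease to
  0, using continuity of \<open>a\<close> and \<open>a'\<close>.\<close>

lemma convex_on_above_tangent_halfline:
  fixes a a' :: "real \<Rightarrow> real"
  assumes convex: "convex_on {0..} a"
    and deriv: "\<And>h. h \<ge> 0 \<Longrightarrow> (a has_real_derivative a' h) (at h within {0..})"
    and C1: "continuous_on {0..} a'"
    and "u \<ge> 0" "v \<ge> 0"
  shows "a u \<ge> a v + a' v * (u - v)"
proof -
  have pos: "a w + a' w * (u - w) \<le> a u" if "w > 0" for w
  proof -
    have "w \<in> interior {0..}" using that by simp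
    then have "a u - a w \<ge> a' w * (u - w)"
      using convex_on_imp_above_tangent[OF convex _ _ _ deriv, of w u] that \<open>u \<ge> 0\<close>
      by (simp add: connected_Ici)
    then show ?thesis by simp
  qed
  show ?thesis
  proof (cases "v = 0")
    case True
    have "continuous_on {0..} a"
      using deriv by (meson DERIV_continuous atLeast_iff continuous_on_eq_continuous_within)
    then have "continuous_on {0..} (\<lambda>w. a w + a' w * (u - w))"
      by (intro continuous_intros C1)
    then have "((\<lambda>w. a w + a' w * (u - w)) \<longlongrightarrow> a 0 + a' 0 * (u - 0)) (at 0 within {0..})"
      unfolding continuous_on_def by (metis atLeast_iff order_refl)
    then have "((\<lambda>w. a w + a' w * (u - w)) \<longlongrightarrow> a 0 + a' 0 * (u - 0)) (at_right 0)"
      by (rule tendsto_within_subset) auto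
    moreover have "\<forall>\<^sub>F w in at_right 0. a w + a' w * (u - w) \<le> a u"
      using pos by (auto simp: eventually_at_filter)
    ultimately show ?thesis
      using True by (intro tendsto_upperbound) auto
  next
    case False
    then show ?thesis using pos \<open>v \<ge> 0\<close> by simp
  qed
qed

section \<open>Setting, and properties of \<open>\<alpha>\<close> and \<open>\<beta>\<close>\<close>

text \<open>\<open>\<alpha>_nontrivial\<close> makes the cost coercive: for \<open>\<alpha>\<close>
  identically zero the maximizers would be those of \<open>f\<close> itself, which need not exist on
  an unbounded space.\<close>

locale hopf_lax =
  fixes f :: "'a::metric_space \<Rightarrow> real"
    and \<alpha> \<alpha>' \<beta> :: "real \<Rightarrow> real"
  assumes compact_balls: "\<And>(x::'a) r. compact (cball x r)"
    and \<alpha>_nonneg: "\<And>h. h \<ge> 0 \<Longrightarrow> \<alpha> h \<ge> 0"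
    and \<alpha>_nontrivial: "\<exists>h\<ge>0. \<alpha> h \<noteq> 0"
    and \<alpha>_convex: "convex_on {0..} \<alpha>"
    and \<alpha>_deriv: "\<And>h. h \<ge> 0 \<Longrightarrow> (\<alpha> has_real_derivative \<alpha>' h) (at h within {0..})"
    and \<alpha>_C1: "continuous_on {0..} \<alpha>'"
    and \<alpha>_0: "\<alpha> 0 = 0"
    and f_usc: "upper_semicontinuous f"
    and f_bdd: "bdd_above (range f)"
    and \<beta>_eq: "\<And>h. h \<ge> 0 \<Longrightarrow> \<beta> h = h * \<alpha>' h - \<alpha> h"
begin

lemmas above_tangent = convex_on_above_tangent_halfline[OF \<alpha>_convex \<alpha>_deriv \<alpha>_C1]

lemma continuous_\<alpha>: "continuous_on {0..} \<alpha>"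
  using \<alpha>_deriv by (meson DERIV_continuous atLeast_iff continuous_on_eq_continuous_within)

lemma continuous_\<beta>: "continuous_on {0..} \<beta>"
proof -
  have "continuous_on {0..} (\<lambda>h. h * \<alpha>' h - \<alpha> h)"
    by (intro continuous_intros \<alpha>_C1 continuous_\<alpha>)
  then show ?thesis
    by (rule continuous_on_eq) (simp add: \<beta>_eq)
qed

text \<open>Add the tangent inequalities at \<open>u\<close> and at \<open>v\<close>.\<close>

lemma \<alpha>'_mono:
  assumes "0 \<le> u" "u \<le> v"
  shows "\<alpha>' u \<le> \<alpha>' v"
proof (cases "u = v")
  case False
  have "\<alpha> u \<ge> \<alpha> v + \<alpha>' v * (u - v)" "\<alpha> v \<ge> \<alpha> u + \<alpha>' u * (v - u)"
    using above_tangent assms by auto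
  then have "\<alpha>' u * (v - u) \<le> \<alpha>' v * (v - u)" by (simp add: algebra_simps)
  then show ?thesis using False assms by simp
qed simp

text \<open>The tangent to \<open>\<alpha>\<close> at \<open>h\<close> takes the value
  \<open>- \<beta> h\<close> at 0, and this intercept decreases as the tangent point moves right.
  The argument uses only first derivatives.\<close>

lemma \<beta>_mono:
  assumes "0 \<le> u" "u \<le> v"
  shows "\<beta> u \<le> \<beta> v"
proof -
  have "\<alpha> u \<ge> \<alpha> v + \<alpha>' v * (u - v)"
    using above_tangent assms by auto
  moreover have "u * \<alpha>' u \<le> u * \<alpha>' v"
    using \<alpha>'_mono assms by (simp add: mult_left_mono)
  ultimately show ?thesis
    using assms by (simp add: \<beta>_eq algebra_simps)
qed

text \<open>The bound is the tangent at a point \<open>k\<close> where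
  \<open>\<alpha> k > 0\<close>, with the constant term dropped. Its slope is positive because the
  same tangent at 0 gives \<open>\<alpha> k \<le> \<alpha>' k * k\<close>.\<close>

lemma \<alpha>_linear_growth:
  obtains c k where "c > 0" "\<And>h. h \<ge> 0 \<Longrightarrow> c * (h - k) \<le> \<alpha> h"
proof -
  obtain k where k: "k \<ge> 0" "\<alpha> k \<noteq> 0" using \<alpha>_nontrivial by blast
  then have pos: "\<alpha> k > 0" using \<alpha>_nonneg by (simp add: order_less_le)
  have "\<alpha> k \<le> \<alpha>' k * k"
    using above_tangent[of 0 k] k \<alpha>_0 by simp
  then have "\<alpha>' k > 0"
    using pos k(1) by (metis less_le_trans not_le zero_less_mult_pos2 order_le_less mult_zero_right)
  moreover have "\<alpha>' k * (h - k) \<le> \<alpha> h" if "h \<ge> 0" for h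
    using above_tangent[of h k] that k(1) pos by simp
  ultimately show ?thesis using that by blast
qed

section \<open>The maximized functional and its dependence on time\<close>

definition gain :: "real \<Rightarrow> 'a \<Rightarrow> 'a \<Rightarrow> real" where
  "gain s x y = f y - s * \<alpha> (dist x y / s)"

lemma sup_conv_eq: "sup_conv \<alpha> f s x = (SUP y. gain s x y)"
  by (simp add: sup_conv_def gain_def)

lemma bdd_above_gain:
  assumes "s > 0"
  shows "bdd_above (range (gain s x))"
proof -
  obtain M where M: "\<And>y. f y \<le> M" using f_bdd by (auto simp: bdd_above_def)
  have "gain s x y \<le> M" for y
  proof -
    have "s * \<alpha> (dist x y / s) \<ge> 0" using \<alpha>_nonneg assms by simp
    then show ?thesis using M[of y] by (simp add: gain_def)
  qed
  then show ?thesis by (rule bdd_aboveI2)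
qed

lemma gain_le_sup_conv: "s > 0 \<Longrightarrow> gain s x y \<le> sup_conv \<alpha> f s x"
  unfolding sup_conv_eq by (rule cSUP_upper[OF _ bdd_above_gain]) auto

text \<open>Replaces equality with a supremum by a pointwise comparison, the form that passes to
  limits.\<close>

lemma maximizers_iff:
  assumes "s > 0"
  shows "y \<in> maximizers \<alpha> f s x \<longleftrightarrow> (\<forall>z. gain s x z \<le> gain s x y)"
proof
  assume "y \<in> maximizers \<alpha> f s x"
  then show "\<forall>z. gain s x z \<le> gain s x y"
    using gain_le_sup_conv[OF assms, of x] by (simp add: maximizers_def gain_def)
next
  assume "\<forall>z. gain s x z \<le> gain s x y"
  then have "sup_conv \<alpha> f s x \<le> gain s x y"
    unfolding sup_conv_eq by (intro cSUP_least) auto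
  then have "sup_conv \<alpha> f s x = gain s x y"
    using gain_le_sup_conv[OF assms] by (rule antisym)
  then show "y \<in> maximizers \<alpha> f s x"
    by (simp add: maximizers_def gain_def)
qed

text \<open>For fixed \<open>y\<close>, \<open>gain s x y\<close> is concave in \<open>s\<close>
  with derivative \<open>\<beta> (dist x y / s)\<close>, so it lies below its tangent at
  \<open>t\<close>. Concretely, evaluate the tangent to \<open>\<alpha>\<close> at
  \<open>r / t\<close> in the point \<open>r / s\<close> and multiply by \<open>s\<close>. The sign
  of \<open>s - t\<close> is free, which later gives bounds on both sides.\<close>

lemma gain_diff_le:
  assumes "s > 0" "t > 0"
  shows "gain s x y - gain t x y \<le> (s - t) * \<beta> (dist x y / t)"
proof -
  define r where "r = dist x y"
  have "r \<ge> 0" by (simp add: r_def)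
  have "\<alpha> (r / t) + \<alpha>' (r / t) * (r / s - r / t) \<le> \<alpha> (r / s)"
    using above_tangent assms \<open>r \<ge> 0\<close> by simp
  then have "s * (\<alpha> (r / t) + \<alpha>' (r / t) * (r / s - r / t)) \<le> s * \<alpha> (r / s)"
    using assms by simp
  moreover have "s * (\<alpha>' (r / t) * (r / s - r / t)) = - ((s - t) * (r / t * \<alpha>' (r / t)))"
    using assms by (simp add: field_simps)
  ultimately show ?thesis
    using assms \<open>r \<ge> 0\<close> unfolding gain_def r_def[symmetric]
    by (simp add: \<beta>_eq algebra_simps)
qed

section \<open>Compactness and stability of maximizers\<close>

text \<open>Coercivity confines the points to one compact ball, and upper semicontinuity identifies
  the limit. Varying both the times and the errors lets one statement serve existence (constant
  time, errors tending to 0), compactness (constant time, no error) and stability as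
  \<open>s\<close> tends to \<open>t\<close> (no error).\<close>

lemma near_maximizers_subseq:
  fixes s :: "nat \<Rightarrow> real" and y :: "nat \<Rightarrow> 'a"
  assumes "t > 0" and s_pos: "\<And>n. s n > 0" and s_lim: "s \<longlonglongrightarrow> t" and e_lim: "e \<longlonglongrightarrow> 0"
    and near: "\<And>n z. gain (s n) x z \<le> gain (s n) x (y n) + e n"
  obtains \<phi> l where "strict_mono \<phi>" "(y \<circ> \<phi>) \<longlonglongrightarrow> l" "l \<in> maximizers \<alpha> f t x"
proof -
  obtain c k where c: "c > 0" and growth: "\<And>h. h \<ge> 0 \<Longrightarrow> c * (h - k) \<le> \<alpha> h"
    by (rule \<alpha>_linear_growth) blast
  obtain M where M: "\<And>z. f z \<le> M" using f_bdd by (auto simp: bdd_above_def)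
  \<comment> \<open>Obtained by comparing \<open>y n\<close> with the competitor \<open>x\<close>,
    whose cost is zero: \<open>f x \<le> M - c * (dist x (y n) - k * s n) + e n\<close>, solved for
    the distance.\<close>
  define R where "R n = (M - f x + e n) / c + k * s n" for n
  have dist_le: "dist x (y n) \<le> R n" for n
  proof -
    have "s n * (c * (dist x (y n) / s n - k)) \<le> s n * \<alpha> (dist x (y n) / s n)"
      using growth s_pos[of n] by simp
    moreover have "s n * (c * (dist x (y n) / s n - k)) = c * (dist x (y n) - k * s n)"
      using s_pos[of n] by (simp add: field_simps)
    moreover have "f x \<le> gain (s n) x (y n) + e n"
      using near[of n x] \<alpha>_0 by (simp add: gain_def)
    ultimately have "c * (dist x (y n) - k * s n) \<le> M - f x + e n"
      using M[of "y n"] unfolding gain_def by linarith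
    then show ?thesis
      using c by (simp add: R_def field_simps)
  qed
  have "R \<longlonglongrightarrow> (M - f x + 0) / c + k * t"
    unfolding R_def using c by (intro tendsto_intros s_lim e_lim) simp
  then obtain B where B: "\<And>n. \<bar>R n\<bar> \<le> B"
    by (metis convergentI convergent_imp_Bseq BseqE real_norm_def)
  have "y n \<in> cball x B" for n
    using dist_le[of n] B[of n] by simp
  then obtain l \<phi> where \<phi>: "strict_mono \<phi>" and l: "(y \<circ> \<phi>) \<longlonglongrightarrow> l"
    using compact_balls[of x B] unfolding compact_eq_seq_compact_metric seq_compact_def by meson
  have s\<phi>: "(s \<circ> \<phi>) \<longlonglongrightarrow> t" and e\<phi>: "(e \<circ> \<phi>) \<longlonglongrightarrow> 0"
    using LIMSEQ_subseq_LIMSEQ[OF _ \<phi>] s_lim e_lim by auto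
  \<comment> \<open>Stated for an arbitrary convergent sequence because it is applied both to
    \<open>y \<circ> \<phi>\<close> and to a constant competitor.\<close>
  have cost_lim: "(\<lambda>n. s (\<phi> n) * \<alpha> (dist x (z n) / s (\<phi> n))) \<longlonglongrightarrow> t * \<alpha> (dist x z' / t)"
    if "z \<longlonglongrightarrow> z'" for z z'
  proof -
    have "(\<lambda>n. dist x (z n) / s (\<phi> n)) \<longlonglongrightarrow> dist x z' / t"
      using s\<phi> that \<open>t > 0\<close> by (intro tendsto_intros) (auto simp: o_def)
    then have "(\<lambda>n. \<alpha> (dist x (z n) / s (\<phi> n))) \<longlonglongrightarrow> \<alpha> (dist x z' / t)"
      using \<open>t > 0\<close> s_pos
      by (intro continuous_on_tendsto_compose[OF continuous_\<alpha>]) (auto simp: less_imp_le)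
    then show ?thesis
      using s\<phi> by (intro tendsto_intros) (auto simp: o_def)
  qed
  have "gain t x z \<le> gain t x l" for z
  \<comment> \<open>Upper semicontinuity only gives \<open>f < f l + d\<close> eventually along the
    subsequence, so the slack \<open>d\<close> is carried through the limit.\<close>
  proof (rule field_le_epsilon)
    fix d :: real assume "d > 0"
    have "open {w. f w < f l + d}"
      using f_usc by (simp add: upper_semicontinuous_def)
    then have "\<forall>\<^sub>F n in sequentially. (y \<circ> \<phi>) n \<in> {w. f w < f l + d}"
      using \<open>d > 0\<close> by (intro topological_tendstoD[OF l]) auto
    then have ev: "\<forall>\<^sub>F n in sequentially. f z - s (\<phi> n) * \<alpha> (dist x z / s (\<phi> n))
        \<le> f l + d - s (\<phi> n) * \<alpha> (dist x ((y \<circ> \<phi>) n) / s (\<phi> n)) + (e \<circ> \<phi>) n"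
    proof eventually_elim
      case (elim n)
      then show ?case using near[of "\<phi> n" z] by (simp add: gain_def)
    qed
    have "f z - t * \<alpha> (dist x z / t) \<le> f l + d - t * \<alpha> (dist x l / t) + 0"
        using tendsto_le[OF sequentially_bot
          tendsto_add[OF tendsto_diff[OF tendsto_const cost_lim[OF l]] e\<phi>]
          tendsto_diff[OF tendsto_const cost_lim[OF tendsto_const]] ev] .
    then show "gain t x z \<le> gain t x l + d" by (simp add: gain_def)
  qed
  then have "l \<in> maximizers \<alpha> f t x"
    using maximizers_iff \<open>t > 0\<close> by blast
  then show ?thesis using that \<phi> l by blast
qed

lemma maximizers_nonempty:
  assumes "t > 0"
  shows "maximizers \<alpha> f t x \<noteq> {}"
proof -
  \<comment> \<open>\<open>Suc n\<close> keeps the slack positive at \<open>n = 0\<close> too; with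
    slack \<open>1 / 0 = 0\<close> the strict inequality would be impossible.\<close>
  have "\<exists>y. sup_conv \<alpha> f t x - 1 / real (Suc n) < gain t x y" for n
    using less_cSUP_iff[OF UNIV_not_empty bdd_above_gain[OF assms], of "sup_conv \<alpha> f t x - 1 / real (Suc n)" x]
    by (simp add: sup_conv_eq)
  then obtain y where y: "\<And>n. sup_conv \<alpha> f t x - 1 / real (Suc n) < gain t x (y n)"
    by metis
  have near: "gain t x z \<le> gain t x (y n) + 1 / real (Suc n)" for n z
    using y[of n] gain_le_sup_conv[OF assms, of x z] by linarith
  have lim: "(\<lambda>n. 1 / real (Suc n)) \<longlonglongrightarrow> 0"
    using LIMSEQ_inverse_real_of_nat by (simp add: inverse_eq_divide)
  obtain l where "l \<in> maximizers \<alpha> f t x"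
    by (rule near_maximizers_subseq
        [where s = "\<lambda>_. t", OF assms assms tendsto_const lim near])
  then show ?thesis by blast
qed

lemma maximizer_selection: "\<exists>y. \<forall>s>0. y s \<in> maximizers \<alpha> f s x"
proof (intro exI allI impI)
  fix s :: real assume "s > 0"
  then show "(SOME y. y \<in> maximizers \<alpha> f s x) \<in> maximizers \<alpha> f s x"
    using maximizers_nonempty[of s x] by (simp add: some_in_eq)
qed

lemma compact_maximizers:
  assumes "t > 0"
  shows "compact (maximizers \<alpha> f t x)"
  unfolding compact_eq_seq_compact_metric seq_compact_def
proof (intro allI impI)
  fix y :: "nat \<Rightarrow> 'a"
  assume "\<forall>n. y n \<in> maximizers \<alpha> f t x"
  then have near: "gain t x z \<le> gain t x (y n) + 0" for n z
    using maximizers_iff assms by auto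
  obtain \<phi> l where "strict_mono \<phi>" "(y \<circ> \<phi>) \<longlonglongrightarrow> l" "l \<in> maximizers \<alpha> f t x"
    by (rule near_maximizers_subseq
        [where s = "\<lambda>_. t", OF assms assms tendsto_const tendsto_const near])
  then show "\<exists>l\<in>maximizers \<alpha> f t x. \<exists>\<phi>. strict_mono \<phi> \<and> (y \<circ> \<phi>) \<longlonglongrightarrow> l"
    by blast
qed

text \<open>This is upper hemicontinuity in time of the set of maximizers: a sequence of selected
  points staying outside \<open>U\<close> would have a subsequence converging to a maximizer at
  \<open>t\<close>, which lies in the open set \<open>U\<close>.\<close>

lemma eventually_maximizers_near:
  fixes y :: "real \<Rightarrow> 'a"
  assumes "t > 0" and y: "\<And>s. s > 0 \<Longrightarrow> y s \<in> maximizers \<alpha> f s x"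
    and "open U" "maximizers \<alpha> f t x \<subseteq> U"
  shows "\<forall>\<^sub>F s in at t. y s \<in> U"
proof -
  \<comment> \<open>The selection is controlled only at positive times; as \<open>t\<close> is
    interior to \<open>{0<..}\<close>, the restriction does not change the filter.\<close>
  have "\<forall>\<^sub>F s in at t within {0<..}. y s \<in> U"
  proof (rule sequentially_imp_eventually_within, intro allI impI)
    fix s assume s: "(\<forall>n. s n \<in> {0<..} \<and> s n \<noteq> t) \<and> s \<longlonglongrightarrow> t"
    show "\<forall>\<^sub>F n in sequentially. y (s n) \<in> U"
    proof (rule ccontr)
      assume "\<not> (\<forall>\<^sub>F n in sequentially. y (s n) \<in> U)"
      then obtain \<psi> :: "nat \<Rightarrow> nat" where \<psi>: "strict_mono \<psi>" and out: "\<And>n. y (s (\<psi> n)) \<notin> U"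
        using not_eventually_sequentiallyD by blast
      have lim: "(\<lambda>n. s (\<psi> n)) \<longlonglongrightarrow> t"
        using LIMSEQ_subseq_LIMSEQ[of s t, OF _ \<psi>] s by (simp add: o_def)
      have pos: "s (\<psi> n) > 0" for n using s by simp
      have near: "gain (s (\<psi> n)) x z \<le> gain (s (\<psi> n)) x (y (s (\<psi> n))) + 0" for n z
        using y maximizers_iff pos by simp
      obtain \<phi> l where l: "((\<lambda>n. y (s (\<psi> n))) \<circ> \<phi>) \<longlonglongrightarrow> l" "l \<in> maximizers \<alpha> f t x"
        by (rule near_maximizers_subseq
            [where s = "\<lambda>n. s (\<psi> n)", OF \<open>t > 0\<close> pos lim tendsto_const near])
      then have "\<forall>\<^sub>F n in sequentially. ((\<lambda>n. y (s (\<psi> n))) \<circ> \<phi>) n \<in> U"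
        using assms(3,4) by (intro topological_tendstoD[OF l(1)]) auto
      then show False using out by auto
    qed
  qed
  then show ?thesis
    using \<open>t > 0\<close> by (simp add: at_within_open[of t "{0<..}"])
qed

section \<open>One-sided derivatives in time\<close>

text \<open>The maximizer at \<open>s\<close> is an admissible competitor at \<open>t\<close>.
  Exchanging \<open>s\<close> and \<open>t\<close> gives the opposite bound.\<close>

lemma sup_conv_diff_le:
  assumes "s > 0" "t > 0" "y \<in> maximizers \<alpha> f s x"
  shows "sup_conv \<alpha> f s x - sup_conv \<alpha> f t x \<le> (s - t) * \<beta> (dist x y / t)"
proof -
  have "sup_conv \<alpha> f s x = gain s x y"
    using assms(3) by (simp add: maximizers_def gain_def)
  then show ?thesis
    using gain_le_sup_conv[OF assms(2), of x y] gain_diff_le[OF assms(1,2), of x y] by linarith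
qed

lemma tendsto_\<beta>:
  assumes "(g \<longlongrightarrow> l) F" "l \<ge> 0" "\<forall>\<^sub>F s in F. g s \<ge> 0"
  shows "((\<lambda>s. \<beta> (g s)) \<longlongrightarrow> \<beta> l) F"
  using continuous_on_tendsto_compose[OF continuous_\<beta> assms(1)] assms(2,3) by simp

text \<open>For \<open>s > t\<close>, the point \<open>ymax\<close> bounds the difference quotient
  below by \<open>\<beta> (r / s)\<close>, while a maximizer \<open>y s\<close> at time
  \<open>s\<close> bounds it above by \<open>\<beta> (dist x (y s) / t)\<close>.\<close>

lemma sup_conv_derivative_right:
  assumes "t > 0" and ymax: "ymax \<in> maximizers \<alpha> f t x"
    and max: "\<And>y. y \<in> maximizers \<alpha> f t x \<Longrightarrow> dist x y \<le> dist x ymax"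
  shows "((\<lambda>s. sup_conv \<alpha> f s x) has_real_derivative \<beta> (dist x ymax / t)) (at_right t)"
proof -
  define r where "r = dist x ymax"
  obtain y where y: "\<And>s. s > 0 \<Longrightarrow> y s \<in> maximizers \<alpha> f s x"
    using maximizer_selection by blast
  have s_pos: "\<forall>\<^sub>F s in at_right t. s > t"
    by (simp add: eventually_at_filter)
  have lower: "((\<lambda>s. \<beta> (r / s)) \<longlongrightarrow> \<beta> (r / t)) (at_right t)"
    using \<open>t > 0\<close> eventually_mono[OF s_pos, of "\<lambda>s. r / s \<ge> 0"]
    by (intro tendsto_\<beta> tendsto_intros) (simp_all add: r_def)
  \<comment> \<open>Stability shows only that \<open>dist x (y s)\<close> is eventually below any
    \<open>b > r\<close>. The maximum with \<open>r\<close> turns this into a limit, and enlarging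
    the argument preserves the upper bound since \<open>\<beta>\<close> is monotone.\<close>
  have "((\<lambda>s. max (dist x (y s)) r) \<longlongrightarrow> r) (at_right t)"
  proof (rule order_tendstoI)
    fix b assume "r < b"
    have "open {z. dist x z < b}" by (intro open_Collect_less continuous_intros)
    moreover have "maximizers \<alpha> f t x \<subseteq> {z. dist x z < b}"
      using max \<open>r < b\<close> by (force simp: r_def)
    ultimately have "\<forall>\<^sub>F s in at t. y s \<in> {z. dist x z < b}"
      using eventually_maximizers_near \<open>t > 0\<close> y by blast
    then have "\<forall>\<^sub>F s in at_right t. y s \<in> {z. dist x z < b}"
      by (rule filter_leD[OF at_le, rotated]) simp
    then show "\<forall>\<^sub>F s in at_right t. max (dist x (y s)) r < b"
      using \<open>r < b\<close> by simp
  qed (auto simp: less_max_iff_disj)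
  then have upper: "((\<lambda>s. \<beta> (max (dist x (y s)) r / t)) \<longlongrightarrow> \<beta> (r / t)) (at_right t)"
    using \<open>t > 0\<close>
    by (intro tendsto_\<beta> tendsto_divide tendsto_const always_eventually allI divide_nonneg_pos)
      (simp_all add: r_def le_max_iff_disj)
  have "\<forall>\<^sub>F s in at_right t.
      \<beta> (r / s) \<le> (sup_conv \<alpha> f s x - sup_conv \<alpha> f t x) / (s - t)"
    using s_pos
  proof eventually_elim
    case (elim s)
    then have "\<beta> (r / s) * (s - t) \<le> sup_conv \<alpha> f s x - sup_conv \<alpha> f t x"
    proof -
      \<comment> \<open>The roles of the two times are exchanged here: \<open>ymax\<close> is a
        maximizer at \<open>t\<close>.\<close>
      have "sup_conv \<alpha> f t x - sup_conv \<alpha> f s x \<le> (t - s) * \<beta> (r / s)"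
        unfolding r_def using elim \<open>t > 0\<close> by (intro sup_conv_diff_le ymax) auto
      moreover have "(t - s) * \<beta> (r / s) = - (\<beta> (r / s) * (s - t))"
        by (simp add: algebra_simps)
      ultimately show ?thesis by linarith
    qed
    then show ?case
      using elim by (simp add: pos_le_divide_eq)
  qed
  moreover have "\<forall>\<^sub>F s in at_right t.
      (sup_conv \<alpha> f s x - sup_conv \<alpha> f t x) / (s - t) \<le> \<beta> (max (dist x (y s)) r / t)"
    using s_pos
  proof eventually_elim
    case (elim s)
    then have "(sup_conv \<alpha> f s x - sup_conv \<alpha> f t x) / (s - t) \<le> \<beta> (dist x (y s) / t)"
      using sup_conv_diff_le[OF _ \<open>t > 0\<close> y, of s] \<open>t > 0\<close>
      by (simp add: pos_divide_le_eq mult.commute)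
    also have "\<dots> \<le> \<beta> (max (dist x (y s)) r / t)"
      using \<open>t > 0\<close> by (intro \<beta>_mono) (auto intro: divide_right_mono)
    finally show ?case .
  qed
  ultimately show ?thesis
    unfolding has_field_derivative_iff r_def[symmetric]
    by (rule tendsto_sandwich[OF _ _ lower upper])
qed

text \<open>Dividing by the negative number \<open>s - t\<close> reverses both bounds: the fixed
  maximizer now bounds the quotient above and the moving one below, so the smallest distance
  appears.\<close>

lemma sup_conv_derivative_left:
  assumes "t > 0" and ymin: "ymin \<in> maximizers \<alpha> f t x"
    and min: "\<And>y. y \<in> maximizers \<alpha> f t x \<Longrightarrow> dist x ymin \<le> dist x y"
  shows "((\<lambda>s. sup_conv \<alpha> f s x) has_real_derivative \<beta> (dist x ymin / t)) (at_left t)"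
proof -
  define r where "r = dist x ymin"
  obtain y where y: "\<And>s. s > 0 \<Longrightarrow> y s \<in> maximizers \<alpha> f s x"
    using maximizer_selection by blast
  \<comment> \<open>Unlike on the right, positivity of \<open>s\<close> has to be required
    separately.\<close>
  have s_bds: "\<forall>\<^sub>F s in at_left t. s \<in> {0<..<t}"
    using eventually_at_left_real[OF \<open>t > 0\<close>] .
  have upper: "((\<lambda>s. \<beta> (r / s)) \<longlongrightarrow> \<beta> (r / t)) (at_left t)"
    using \<open>t > 0\<close> eventually_mono[OF s_bds, of "\<lambda>s. r / s \<ge> 0"]
    by (intro tendsto_\<beta> tendsto_intros) (simp_all add: r_def)
  \<comment> \<open>Truncation from above by \<open>r\<close> plays the dual role: only a lower
    bound on the limiting distances is available, and a smaller argument keeps the lower bound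
    valid.\<close>
  have "((\<lambda>s. min (dist x (y s)) r) \<longlongrightarrow> r) (at_left t)"
  proof (rule order_tendstoI)
    fix b assume "b < r"
    have "open {z. b < dist x z}" by (intro open_Collect_less continuous_intros)
    moreover have "maximizers \<alpha> f t x \<subseteq> {z. b < dist x z}"
      using min \<open>b < r\<close> by (force simp: r_def)
    ultimately have "\<forall>\<^sub>F s in at t. y s \<in> {z. b < dist x z}"
      using eventually_maximizers_near \<open>t > 0\<close> y by blast
    then have "\<forall>\<^sub>F s in at_left t. y s \<in> {z. b < dist x z}"
      by (rule filter_leD[OF at_le, rotated]) simp
    then show "\<forall>\<^sub>F s in at_left t. b < min (dist x (y s)) r"
      using \<open>b < r\<close> by simp
  qed (auto simp: min_less_iff_disj)
  then have lower: "((\<lambda>s. \<beta> (min (dist x (y s)) r / t)) \<longlongrightarrow> \<beta> (r / t)) (at_left t)"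
    using \<open>t > 0\<close> by (intro tendsto_\<beta> tendsto_intros) (auto simp: r_def)
  have "\<forall>\<^sub>F s in at_left t.
      \<beta> (min (dist x (y s)) r / t) \<le> (sup_conv \<alpha> f s x - sup_conv \<alpha> f t x) / (s - t)"
    using s_bds
  proof eventually_elim
    case (elim s)
    have "\<beta> (min (dist x (y s)) r / t) \<le> \<beta> (dist x (y s) / t)"
      using \<open>t > 0\<close> by (intro \<beta>_mono) (auto simp: r_def intro: divide_right_mono)
    also have "\<dots> \<le> (sup_conv \<alpha> f s x - sup_conv \<alpha> f t x) / (s - t)"
      using sup_conv_diff_le[OF _ \<open>t > 0\<close> y, of s] elim
      by (simp add: neg_le_divide_eq mult.commute)
    finally show ?case .
  qed
  moreover have "\<forall>\<^sub>F s in at_left t.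
      (sup_conv \<alpha> f s x - sup_conv \<alpha> f t x) / (s - t) \<le> \<beta> (r / s)"
    using s_bds
  proof eventually_elim
    case (elim s)
    then have "\<beta> (r / s) * (s - t) \<le> sup_conv \<alpha> f s x - sup_conv \<alpha> f t x"
    proof -
      have "sup_conv \<alpha> f t x - sup_conv \<alpha> f s x \<le> (t - s) * \<beta> (r / s)"
        unfolding r_def using elim \<open>t > 0\<close> by (intro sup_conv_diff_le ymin) auto
      moreover have "(t - s) * \<beta> (r / s) = - (\<beta> (r / s) * (s - t))"
        by (simp add: algebra_simps)
      ultimately show ?thesis by linarith
    qed
    then show ?case
      using elim by (simp add: neg_divide_le_eq)
  qed
  ultimately show ?thesis
    unfolding has_field_derivative_iff r_def[symmetric]
    by (rule tendsto_sandwich[OF _ _ lower upper])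
qed

end

section \<open>Extremal distances and the derivative formulas\<close>

text \<open>The maximum and minimum are expressed by points attaining them, so that their existence
  is part of the claim; it follows from continuity of the distance on a nonempty compact set.
  "Increasing" is read as monotone and not identically zero.\<close>

theorem theorem1p10:
  fixes f :: "'a::complete_space \<Rightarrow> real"
    and \<alpha> \<alpha>' \<beta> :: "real \<Rightarrow> real"
  assumes separable: "separable_space (euclidean :: 'a topology)"
    and compact_balls: "\<And>(x::'a) r. compact (cball x r)"
    and \<alpha>_nonneg: "\<And>h. h \<ge> 0 \<Longrightarrow> \<alpha> h \<ge> 0"
    and \<alpha>_mono: "mono_on {0..} \<alpha>"
    and \<alpha>_nontrivial: "\<exists>h\<ge>0. \<alpha> h \<noteq> 0"
    and \<alpha>_convex: "convex_on {0..} \<alpha>"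
    and \<alpha>_deriv: "\<And>h. h \<ge> 0 \<Longrightarrow> (\<alpha> has_real_derivative \<alpha>' h) (at h within {0..})"
    and \<alpha>_C1: "continuous_on {0..} \<alpha>'"
    and \<alpha>_0: "\<alpha> 0 = 0"
    and f_usc: "upper_semicontinuous f"
    and f_bdd: "bdd_above (range f)"
    and \<beta>_eq: "\<And>h. h \<ge> 0 \<Longrightarrow> \<beta> h = h * \<alpha>' h - \<alpha> h"
  shows "\<forall>t>0. \<forall>x.
           maximizers \<alpha> f t x \<noteq> {} \<and> compact (maximizers \<alpha> f t x) \<and>
           (\<exists>ymax \<in> maximizers \<alpha> f t x.
              (\<forall>y \<in> maximizers \<alpha> f t x. dist x y \<le> dist x ymax) \<and>
              ((\<lambda>s. sup_conv \<alpha> f s x) has_real_derivative \<beta> (1 / t * dist x ymax)) (at_right t)) \<and>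
           (\<exists>ymin \<in> maximizers \<alpha> f t x.
              (\<forall>y \<in> maximizers \<alpha> f t x. dist x ymin \<le> dist x y) \<and>
              ((\<lambda>s. sup_conv \<alpha> f s x) has_real_derivative \<beta> (1 / t * dist x ymin)) (at_left t))"
proof (intro allI impI conjI)
  fix t :: real and x :: 'a
  assume t: "t > 0"
  interpret hopf_lax f \<alpha> \<alpha>' \<beta>
    by unfold_locales (fact assms)+
  show ne: "maximizers \<alpha> f t x \<noteq> {}" and cpt: "compact (maximizers \<alpha> f t x)"
    using maximizers_nonempty compact_maximizers t by auto
  have cont: "continuous_on (maximizers \<alpha> f t x) (dist x)"
    by (intro continuous_intros)
  show "\<exists>ymax \<in> maximizers \<alpha> f t x.
      (\<forall>y \<in> maximizers \<alpha> f t x. dist x y \<le> dist x ymax) \<and>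
      ((\<lambda>s. sup_conv \<alpha> f s x) has_real_derivative \<beta> (1 / t * dist x ymax)) (at_right t)"
  proof -
    obtain ymax where "ymax \<in> maximizers \<alpha> f t x"
      and "\<forall>y \<in> maximizers \<alpha> f t x. dist x y \<le> dist x ymax"
      using continuous_attains_sup[OF cpt ne cont] by blast
    moreover from this have "((\<lambda>s. sup_conv \<alpha> f s x) has_real_derivative \<beta> (dist x ymax / t)) (at_right t)"
      by (intro sup_conv_derivative_right[OF t]) auto
    ultimately show ?thesis by (intro bexI[of _ ymax] conjI) simp_all
  qed
  show "\<exists>ymin \<in> maximizers \<alpha> f t x.
      (\<forall>y \<in> maximizers \<alpha> f t x. dist x ymin \<le> dist x y) \<and>
      ((\<lambda>s. sup_conv \<alpha> f s x) has_real_derivative \<beta> (1 / t * dist x ymin)) (at_left t)"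
  proof -
    obtain ymin where "ymin \<in> maximizers \<alpha> f t x"
      and "\<forall>y \<in> maximizers \<alpha> f t x. dist x ymin \<le> dist x y"
      using continuous_attains_inf[OF cpt ne cont] by blast
    moreover from this have "((\<lambda>s. sup_conv \<alpha> f s x) has_real_derivative \<beta> (dist x ymin / t)) (at_left t)"
      by (intro sup_conv_derivative_left[OF t]) auto
    ultimately show ?thesis by (intro bexI[of _ ymin] conjI) simp_all
  qed
qed

end
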